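(* Let $X$ be a real Banach space, let $0<p<+\infty$, and let $\sum_i x_i$ be a series in $X$. The following conditions are equivalent: (1) $\sum_i x_i$ is a weakly unconditionally Cauchy series. (2) $S_{\mathrm{w}_p}\left(\sum_i x_i\right)$ is a complete space. (3) $c_0\subset S_{\mathrm{w}_p}\left(\sum_i x_i\right)$.
   Context: A sequence $(y_k)_k$ in a normed space $X$ is strongly $p$-Cesàro summable (or $\mathrm{w}_p$ summable) to $L\in X$ if $\lim_n \frac1n\sum_{k=1}^n\|y_k-L\|^p=0$; it is $\mathrm{w}_p$ summable if this holds for some $L\in X$. A series $\sum_i y_i$ in $X$ is called $\mathrm{w}_p$ summable if its sequence of partial sums $\left(\sum_{i=1}^k y_i\right)_k$ is $\mathrm{w}_p$ summable. A series $\sum_i x_i$ in $X$ is weakly unconditionally Cauchy (wuc) if $\sum_{i=1}^\infty |f(x_i)|<\infty$ for every $f\in X^*$. For a series $\sum_i x_i$ in $X$, $$S_{\mathrm{w}_p}\left(\sum_i x_i\right)=\left\{(a_i)_i\in\ell_\infty:\ \sum_i a_i x_i \text{ is } \mathrm{w}_p \text{ summable}\right\},$$ endowed with the supremum norm; $\ell_\infty$ is the space of bounded scalar sequences and $c_0$ its subspace of null sequences. *)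

theory Defs
  imports "HOL-Analysis.Analysis"
begin

text \<open>
  Sequences \<open>y\<close> of vectors are indexed by \<open>k = 1, 2, \<dots>\<close> (the value \<open>y 0\<close> is ignored). The terms
  of a series are indexed by \<open>i = 0, 1, \<dots>\<close>, so its \<open>k\<close>-th partial sum, the sum of its first \<open>k\<close>
  terms, is \<open>\<Sum>i<k. x i\<close>.
\<close>

definition wp_summable_to :: "real \<Rightarrow> (nat \<Rightarrow> 'a::real_normed_vector) \<Rightarrow> 'a \<Rightarrow> bool" where
  "wp_summable_to p y L \<longleftrightarrow>
     (\<lambda>n. (1 / real n) * (\<Sum>k = 1..n. norm (y k - L) powr p)) \<longlonglongrightarrow> 0"

definition wp_summable :: "real \<Rightarrow> (nat \<Rightarrow> 'a::real_normed_vector) \<Rightarrow> bool" where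
  "wp_summable p y \<longleftrightarrow> (\<exists>L. wp_summable_to p y L)"

definition wp_summable_series :: "real \<Rightarrow> (nat \<Rightarrow> 'a::real_normed_vector) \<Rightarrow> bool" where
  "wp_summable_series p x \<longleftrightarrow> wp_summable p (\<lambda>k. \<Sum>i<k. x i)"

definition wuc_series :: "(nat \<Rightarrow> 'a::real_normed_vector) \<Rightarrow> bool" where
  "wuc_series x \<longleftrightarrow> (\<forall>f :: 'a \<Rightarrow>\<^sub>L real. summable (\<lambda>i. \<bar>blinfun_apply f (x i)\<bar>))"

text \<open>
  The topology of \<^typ>\<open>nat\<close> is discrete, so its bounded continuous real functions are exactly the
  bounded real sequences, and the norm of \<^typ>\<open>nat \<Rightarrow>\<^sub>C real\<close> is the supremum norm.
\<close>

type_synonym linfty = "nat \<Rightarrow>\<^sub>C real"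

definition c0 :: "linfty set" where
  "c0 = {a. apply_bcontfun a \<longlonglongrightarrow> 0}"

definition S_wp :: "real \<Rightarrow> (nat \<Rightarrow> 'a::real_normed_vector) \<Rightarrow> linfty set" where
  "S_wp p x = {a. wp_summable_series p (\<lambda>i. apply_bcontfun a i *\<^sub>R x i)}"

end

theory Submission
  imports Defs
begin

text \<open>
  If the series is weakly unconditionally Cauchy, the finite sums \<open>\<Sum>i<n. a i *\<^sub>R x i\<close> with
  \<open>\<bar>a i\<bar> \<le> 1\<close> are weakly bounded, hence norm bounded, so sup-norm convergence of multipliers makes
  the partial sums converge uniformly; strong Cesaro limits survive uniform convergence because
  uniformly close sequences have close limits. Hence the multiplier space is closed. A closed
  multiplier space contains \<open>c0\<close>, the closure of the finitely supported sequences. Finally, if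
  \<open>\<Sum>i. \<bar>f (x i)\<bar>\<close> diverges for some functional \<open>f\<close>, there is a null sequence \<open>a\<close> for which \<open>f\<close> of
  the partial sums of \<open>\<Sum>i. a i *\<^sub>R x i\<close> tends to infinity, which excludes summability.
\<close>

section \<open>Hahn-Banach and uniform boundedness\<close>

definition sublinear :: "('a::real_vector \<Rightarrow> real) \<Rightarrow> bool" where
  "sublinear q \<longleftrightarrow> (\<forall>x y. q (x + y) \<le> q x + q y) \<and> (\<forall>t\<ge>0. \<forall>x. q (t *\<^sub>R x) = t * q x)"

lemma sublinear_add: "sublinear q \<Longrightarrow> q (x + y) \<le> q x + q y"
  and sublinear_scaleR: "sublinear q \<Longrightarrow> 0 \<le> t \<Longrightarrow> q (t *\<^sub>R x) = t * q x"
  by (auto simp: sublinear_def)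

lemma sublinear_0: "sublinear q \<Longrightarrow> q 0 = 0"
  using sublinear_scaleR[of q 0 0] by simp

lemma sublinear_minus_le: "sublinear q \<Longrightarrow> - q (- x) \<le> q x"
  using sublinear_add[of q x "- x"] sublinear_0[of q] by simp

text \<open>One inequality suffices for homogeneity: applied with \<open>1 / t\<close> to
  \<open>t *\<^sub>R x\<close> it gives the reverse one.\<close>

lemma sublinearI:
  fixes q :: "'a::real_vector \<Rightarrow> real"
  assumes add: "\<And>x y. q (x + y) \<le> q x + q y"
    and zero: "q 0 = 0"
    and scale: "\<And>t x. 0 < t \<Longrightarrow> q (t *\<^sub>R x) \<le> t * q x"
  shows "sublinear q"
  unfolding sublinear_def
proof (intro conjI allI impI add)
  fix t :: real and x :: 'a
  assume "0 \<le> t"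
  show "q (t *\<^sub>R x) = t * q x"
  proof (cases "t = 0")
    case False
    with \<open>0 \<le> t\<close> have t: "0 < t" by simp
    have "q x \<le> (1 / t) * q (t *\<^sub>R x)"
      using scale[of "1 / t" "t *\<^sub>R x"] t by simp
    then have "t * q x \<le> q (t *\<^sub>R x)"
      using t by (simp add: field_simps)
    with scale[OF t, of x] show ?thesis by simp
  qed (simp add: zero)
qed

lemma sublinear_norm: "sublinear norm"
  by (simp add: sublinear_def norm_triangle_ineq)

text \<open>Subadditivity is where the chain matters: the smaller of \<open>q\<close> and
  \<open>r\<close> bounds the infimum at \<open>x + y\<close> by \<open>q x + r y\<close>, so the
  two infima can be taken independently.\<close>

lemma sublinear_INF_chain:
  fixes C :: "('a::real_vector \<Rightarrow> real) set"
  assumes ne: "C \<noteq> {}"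
    and sub: "\<And>q. q \<in> C \<Longrightarrow> sublinear q"
    and bdd: "\<And>x. bdd_below ((\<lambda>q. q x) ` C)"
    and chain: "\<And>q r. q \<in> C \<Longrightarrow> r \<in> C \<Longrightarrow> q \<le> r \<or> r \<le> q"
  shows "sublinear (\<lambda>x. INF q\<in>C. q x)"
proof (rule sublinearI)
  have lower: "(INF q\<in>C. q x) \<le> q x" if "q \<in> C" for q x
    using that by (rule cINF_lower[OF bdd])
  show "(INF q\<in>C. q (x + y)) \<le> (INF q\<in>C. q x) + (INF q\<in>C. q y)" for x y
  proof -
    have *: "(INF q\<in>C. q (x + y)) \<le> q x + r y" if "q \<in> C" "r \<in> C" for q r
    proof -
      have "q \<le> r \<or> r \<le> q"
        using that by (rule chain)
      with \<open>q \<in> C\<close> \<open>r \<in> C\<close> obtain s where s: "s \<in> C" "s \<le> q" "s \<le> r"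
        by blast
      have "(INF q\<in>C. q (x + y)) \<le> s x + s y"
        using lower[OF s(1)] sublinear_add[OF sub[OF s(1)]] order_trans by blast
      also have "\<dots> \<le> q x + r y"
        using s by (simp add: add_mono le_funD)
      finally show ?thesis .
    qed
    have "(INF q\<in>C. q (x + y)) - r y \<le> (INF q\<in>C. q x)" if "r \<in> C" for r
      using *[OF _ that] by (intro cINF_greatest ne) (simp add: algebra_simps)
    then have "(INF q\<in>C. q (x + y)) - (INF q\<in>C. q x) \<le> (INF r\<in>C. r y)"
      by (intro cINF_greatest ne) (simp add: algebra_simps)
    then show ?thesis by simp
  qed
  show "(INF q\<in>C. q 0) = 0"
    using ne sub by (simp add: sublinear_0)
  show "(INF q\<in>C. q (t *\<^sub>R x)) \<le> t * (INF q\<in>C. q x)" if t: "0 < t" for t x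
  proof -
    have "(INF q\<in>C. q (t *\<^sub>R x)) / t \<le> (INF q\<in>C. q x)"
    proof (intro cINF_greatest ne)
      fix q assume "q \<in> C"
      then show "(INF q\<in>C. q (t *\<^sub>R x)) / t \<le> q x"
        using lower[of q "t *\<^sub>R x"] sublinear_scaleR[OF sub, of q t x] t
        by (simp add: field_simps)
    qed
    then show ?thesis using t by (simp add: field_simps)
  qed
qed

text \<open>
  Lowering a sublinear functional so that it becomes additive along \<open>y\<close>: this single
  construction shows that minimal sublinear functionals are linear, and it also yields norming
  functionals.
\<close>
lemma sublinear_lower:
  fixes q :: "'a::real_vector \<Rightarrow> real"
  assumes q: "sublinear q"
  obtains r where "sublinear r" "r \<le> q" "r (- y) \<le> - q y"
proof
  \<comment> \<open>The infimum over \<open>t \<ge> 0\<close> is finite because subadditivity keeps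
    \<open>g x t\<close> above \<open>- q (- x)\<close>. The value \<open>t = 0\<close> yields
    \<open>r \<le> q\<close>, and \<open>t = 1\<close> at \<open>- y\<close> yields the bound
    \<open>- q y\<close>.\<close>
  define g where "g x t = q (x + t *\<^sub>R y) - t * q y" for x t
  define r where "r x = (INF t\<in>{0..}. g x t)" for x
  have "- q (- x) \<le> g x t" if "0 \<le> t" for x t
    using sublinear_add[OF q, of "x + t *\<^sub>R y" "- x"] sublinear_scaleR[OF q that, of y]
    by (simp add: g_def)
  then have "bdd_below (g x ` {0..})" for x
    by (intro bdd_belowI[where m = "- q (- x)"]) auto
  then have lower: "r x \<le> g x t" if "0 \<le> t" for x t
    unfolding r_def using that by (intro cINF_lower) auto
  have greatest: "c \<le> r x" if "\<And>t. 0 \<le> t \<Longrightarrow> c \<le> g x t" for c x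
    unfolding r_def using that by (intro cINF_greatest) auto
  show "sublinear r"
  proof (rule sublinearI)
    show "r (x + z) \<le> r x + r z" for x z
    proof -
      have *: "r (x + z) \<le> g x s + g z t" if "0 \<le> s" "0 \<le> t" for s t
      proof -
        have "r (x + z) \<le> g (x + z) (s + t)"
          using that by (intro lower) simp
        also have "\<dots> \<le> g x s + g z t"
          using sublinear_add[OF q, of "x + s *\<^sub>R y" "z + t *\<^sub>R y"]
          by (simp add: g_def algebra_simps)
        finally show ?thesis .
      qed
      have "r (x + z) - g z t \<le> r x" if "0 \<le> t" for t
        using *[OF _ that] by (intro greatest) (simp add: algebra_simps)
      then have "r (x + z) - r x \<le> r z"
        by (intro greatest) (simp add: algebra_simps)
      then show ?thesis by simp
    qed
    show "r 0 = 0"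
      unfolding r_def g_def using sublinear_scaleR[OF q] by simp
    show "r (a *\<^sub>R x) \<le> a * r x" if a: "0 < a" for a x
    proof -
      have "r (a *\<^sub>R x) / a \<le> r x"
      proof (rule greatest)
        fix t :: real assume "0 \<le> t"
        have "r (a *\<^sub>R x) \<le> g (a *\<^sub>R x) (a * t)"
          using a \<open>0 \<le> t\<close> by (intro lower) simp
        also have "\<dots> = a * g x t"
          using sublinear_scaleR[OF q, of a "x + t *\<^sub>R y"] a
          by (simp add: g_def algebra_simps)
        finally show "r (a *\<^sub>R x) / a \<le> g x t"
          using a by (simp add: field_simps)
      qed
      then show ?thesis using a by (simp add: field_simps)
    qed
  qed
  show "r \<le> q"
    using lower[of 0] by (simp add: g_def le_fun_def)
  show "r (- y) \<le> - q y"
    using lower[of 1 "- y"] sublinear_0[OF q] by (simp add: g_def)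
qed

text \<open>Zorn's lemma for the reversed order gives a minimal sublinear functional below
  \<open>p\<close>. Lowering it along any \<open>y\<close> changes nothing, so it is odd, and an odd
  sublinear functional is linear.\<close>

theorem Hahn_Banach_sublinear:
  fixes p :: "'a::real_vector \<Rightarrow> real"
  assumes p: "sublinear p"
  obtains f where "linear f" "f \<le> p"
proof -
  define A where "A = {q. sublinear q \<and> q \<le> p}"
  \<comment> \<open>This common lower bound makes the pointwise infimum of a chain finite.\<close>
  have lower: "- p (- x) \<le> q x" if "q \<in> A" for q x
  proof -
    have "q (- x) \<le> p (- x)"
      using that by (auto simp: A_def le_fun_def)
    then show ?thesis
      using that sublinear_minus_le[of q x] by (auto simp: A_def)
  qed
  have "\<exists>m\<in>A. \<forall>q\<in>A. q \<le> m \<longrightarrow> q = m"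
  proof (rule predicate_Zorn)
    show "partial_order_on A (relation_of (\<lambda>x y. y \<le> x) A)"
      by (rule partial_order_on_relation_ofI) auto
    fix C assume "C \<in> Chains (relation_of (\<lambda>x y. y \<le> x) A)"
    then have CA: "C \<subseteq> A" and chain: "\<And>q r. q \<in> C \<Longrightarrow> r \<in> C \<Longrightarrow> q \<le> r \<or> r \<le> q"
      by (auto simp: Chains_def relation_of_def)
    show "\<exists>u\<in>A. \<forall>a\<in>C. u \<le> a"
    proof (cases "C = {}")
      case True
      then show ?thesis using p by (auto simp: A_def)
    next
      case False
      define u where "u = (\<lambda>x. INF q\<in>C. q x)"
      have bdd: "bdd_below ((\<lambda>q. q x) ` C)" for x
        using lower CA by (intro bdd_belowI[where m = "- p (- x)"]) auto
      have u: "u \<le> q" if "q \<in> C" for q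
        unfolding u_def using that bdd by (auto intro!: le_funI cINF_lower)
      have "sublinear u"
        unfolding u_def using False CA bdd chain
        by (intro sublinear_INF_chain) (auto simp: A_def)
      moreover have "u \<le> p"
        using False CA u by (force simp: A_def intro: order_trans)
      ultimately show ?thesis using u by (auto simp: A_def)
    qed
  qed
  then obtain m where mA: "m \<in> A" and min: "\<And>q. q \<in> A \<Longrightarrow> q \<le> m \<Longrightarrow> q = m"
    by blast
  then have m: "sublinear m" "m \<le> p" by (auto simp: A_def)
  have minus: "m (- y) = - m y" for y
  proof -
    obtain r where r: "sublinear r" "r \<le> m" "r (- y) \<le> - m y"
      using sublinear_lower[OF m(1)] .
    then have "r = m"
      using min m by (auto simp: A_def intro: order_trans)
    with r sublinear_minus_le[OF m(1), of y] show ?thesis by simp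
  qed
  have "linear m"
  proof (rule linearI)
    show "m (x + y) = m x + m y" for x y
      using sublinear_add[OF m(1), of x y] sublinear_add[OF m(1), of "- x" "- y"]
        minus[of "x + y"] minus[of x] minus[of y] by simp
    show "m (t *\<^sub>R x) = t *\<^sub>R m x" for t x
      using sublinear_scaleR[OF m(1), of t x] sublinear_scaleR[OF m(1), of "- t" x]
        minus[of "t *\<^sub>R x"]
      by (cases "0 \<le> t") auto
  qed
  with m that show ?thesis by blast
qed

text \<open>The norm is lowered along \<open>v\<close> before a linear functional is taken below it:
  the value at \<open>- v\<close> is then at most \<open>- norm v\<close>, which forces equality at
  \<open>v\<close>.\<close>

corollary norming_functional:
  fixes v :: "'a::real_normed_vector"
  obtains f :: "'a \<Rightarrow>\<^sub>L real" where "norm f \<le> 1" "f v = norm v"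
proof -
  obtain r :: "'a \<Rightarrow> real" where r: "sublinear r" "r \<le> norm" "r (- v) \<le> - norm v"
    using sublinear_lower[OF sublinear_norm] .
  obtain f where f: "linear f" "f \<le> r"
    using Hahn_Banach_sublinear[OF r(1)] .
  have le: "f x \<le> norm x" for x
    using f(2) r(2) by (meson le_funD order_trans)
  have abs: "\<bar>f x\<bar> \<le> norm x" for x
    using le[of x] le[of "- x"] linear_neg[OF f(1), of x] by auto
  have bl: "bounded_linear f"
    using f(1) abs by (intro bounded_linear_intro[where K = 1])
      (auto simp: linear_add linear_cmul)
  show ?thesis
  proof
    show "norm (Blinfun f) \<le> 1"
      by (rule norm_blinfun_bound) (use abs in \<open>auto simp: bounded_linear_Blinfun_apply[OF bl]\<close>)
    have "f (- v) \<le> - norm v"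
      using f(2) r(3) by (meson le_funD order_trans)
    then show "blinfun_apply (Blinfun f) v = norm v"
      using le[of v] linear_neg[OF f(1), of v] by (simp add: bounded_linear_Blinfun_apply[OF bl])
  qed
qed

text \<open>By Baire's theorem one of the closed sets \<open>F m\<close> contains a ball; comparing
  points of the ball with its centre bounds all operator norms at once.\<close>

theorem uniform_boundedness:
  fixes T :: "('a::banach \<Rightarrow>\<^sub>L 'b::real_normed_vector) set"
  assumes pointwise: "\<And>v. bounded ((\<lambda>t. blinfun_apply t v) ` T)"
  shows "bounded T"
proof -
  define F where "F m = {v. \<forall>t\<in>T. norm (blinfun_apply t v) \<le> real m}" for m
  have closed: "closed (F m)" for m
  proof -
    have "F m = (\<Inter>t\<in>T. {v. norm (blinfun_apply t v) \<le> real m})"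
      by (auto simp: F_def)
    moreover have "closed {v. norm (blinfun_apply t v) \<le> real m}" for t :: "'a \<Rightarrow>\<^sub>L 'b"
      by (intro closed_Collect_le continuous_intros)
    ultimately show ?thesis by auto
  qed
  have "v \<in> (\<Union>m. F m)" for v
  proof -
    obtain b where "\<forall>t\<in>T. norm (blinfun_apply t v) \<le> b"
      using pointwise[of v] by (auto simp: bounded_iff)
    moreover obtain m where "b \<le> real m"
      using real_arch_simple by blast
    ultimately show ?thesis
      unfolding F_def by (auto intro: order_trans)
  qed
  then have "(\<Union>m. F m) = UNIV" by blast
  then have "interior (\<Union>(range F)) \<noteq> {}" by simp
  moreover have "interior (\<Union>(range F)) = {}" if "\<And>m. interior (F m) = {}"
    using Baire_category_alt[of "euclidean :: 'a topology" "range F"] closed that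
    by (auto simp: completely_metrizable_space_euclidean)
  ultimately obtain m c where "c \<in> interior (F m)" by blast
  then obtain e where e: "0 < e" "cball c e \<subseteq> F m"
    by (meson mem_interior_cball)
  have "norm t \<le> 2 * real m / e" if t: "t \<in> T" for t
  proof (rule norm_blinfun_bound)
    fix v
    show "norm (blinfun_apply t v) \<le> 2 * real m / e * norm v"
    proof (cases "v = 0")
      case False
      \<comment> \<open>This factor stretches \<open>v\<close> to length \<open>e\<close>, so
        \<open>c + a *\<^sub>R v\<close> still lies in the ball.\<close>
      define a where "a = e / norm v"
      have a: "0 < a" using e False by (simp add: a_def)
      have "c + a *\<^sub>R v \<in> cball c e" "c \<in> cball c e"
        using e False by (auto simp: a_def dist_norm)
      then have "c + a *\<^sub>R v \<in> F m" "c \<in> F m"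
        using e by blast+
      then have 1: "norm (blinfun_apply t (c + a *\<^sub>R v)) \<le> m" "norm (blinfun_apply t c) \<le> m"
        using t by (auto simp: F_def)
      have "a * norm (blinfun_apply t v)
          = norm (blinfun_apply t (c + a *\<^sub>R v) - blinfun_apply t c)"
        using a by (simp add: blinfun.bilinear_simps)
      also have "\<dots> \<le> 2 * real m"
        using norm_triangle_ineq4[of "blinfun_apply t (c + a *\<^sub>R v)" "blinfun_apply t c"] 1
        by simp
      finally show ?thesis
        using e False by (simp add: a_def field_simps)
    qed simp
  qed (use e in auto)
  then show ?thesis by (auto simp: bounded_iff)
qed

text \<open>Vectors act on the dual by evaluation, and the dual is a Banach space even if the space
  itself is not, so uniform boundedness applies there. Norming functionals show that evaluation does
  not decrease the norm.\<close>

corollary weakly_bounded_imp_bounded: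
  fixes S :: "'a::real_normed_vector set"
  assumes "\<And>f :: 'a \<Rightarrow>\<^sub>L real. bounded (blinfun_apply f ` S)"
  shows "bounded S"
proof -
  define ev :: "'a \<Rightarrow> ('a \<Rightarrow>\<^sub>L real) \<Rightarrow>\<^sub>L real" where "ev v = Blinfun (\<lambda>f. blinfun_apply f v)" for v
  have ev: "blinfun_apply (ev v) f = blinfun_apply f v" for v f
    unfolding ev_def by (simp add: bounded_linear_Blinfun_apply blinfun.bounded_linear_left)
  have "bounded (ev ` S)"
    by (rule uniform_boundedness) (use assms in \<open>simp add: image_image ev\<close>)
  then obtain b where b: "\<And>v. v \<in> S \<Longrightarrow> norm (ev v) \<le> b"
    by (auto simp: bounded_iff)
  have "norm v \<le> b" if v: "v \<in> S" for v
  proof -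
    obtain f :: "'a \<Rightarrow>\<^sub>L real" where f: "norm f \<le> 1" "f v = norm v"
      by (rule norming_functional)
    have "norm v \<le> norm (blinfun_apply (ev v) f)"
      by (simp add: ev f)
    also have "\<dots> \<le> norm (ev v) * norm f"
      by (rule norm_blinfun)
    also have "\<dots> \<le> norm (ev v)"
      using f mult_left_mono[of "norm f" 1 "norm (ev v)"] by simp
    finally show ?thesis using b[OF v] by simp
  qed
  then show ?thesis by (auto simp: bounded_iff)
qed

section \<open>Strong Cesaro limits\<close>

text \<open>The factor comes from \<open>u + v \<le> 2 * max u v\<close>. This substitute for the
  triangle inequality covers \<open>p < 1\<close> and \<open>p \<ge> 1\<close> alike.\<close>

lemma powr_add_le:
  fixes u v p :: real
  assumes "0 \<le> u" "0 \<le> v" "0 < p"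
  shows "(u + v) powr p \<le> 2 powr p * (u powr p + v powr p)"
proof -
  have "(u + v) powr p \<le> (2 * max u v) powr p"
    using assms by (intro powr_mono2) auto
  also have "\<dots> = 2 powr p * max u v powr p"
    using assms by (simp add: powr_mult)
  also have "\<dots> \<le> 2 powr p * (u powr p + v powr p)"
    by (intro mult_left_mono) (auto simp: max_def)
  finally show ?thesis .
qed

lemma averages_not_null:
  fixes u :: "nat \<Rightarrow> real"
  assumes nonneg: "\<And>k. 0 \<le> u k" and c: "0 < c" and ge: "\<forall>\<^sub>F k in sequentially. c \<le> u k"
  shows "\<not> (\<lambda>n. (1 / real n) * (\<Sum>k = 1..n. u k)) \<longlonglongrightarrow> 0"
proof
  assume "(\<lambda>n. (1 / real n) * (\<Sum>k = 1..n. u k)) \<longlonglongrightarrow> 0"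
  then have "\<forall>\<^sub>F n in sequentially. (1 / real n) * (\<Sum>k = 1..n. u k) < c / 2"
    by (rule order_tendstoD) (use c in simp)
  then obtain M where M: "\<And>n. n \<ge> M \<Longrightarrow> (1 / real n) * (\<Sum>k = 1..n. u k) < c / 2"
    by (auto simp: eventually_sequentially)
  obtain N where N: "\<And>n. n \<ge> N \<Longrightarrow> c \<le> u n"
    using ge by (auto simp: eventually_sequentially)
  \<comment> \<open>This \<open>n\<close> is beyond \<open>M\<close>, and at least half of the
    indices \<open>1..n\<close> exceed \<open>N\<close>, so the average is at least
    \<open>c / 2\<close>.\<close>
  define n where "n = 2 * (N + M + 1)"
  have "real n / 2 * c \<le> real (card {N + 1..n}) * c"
    using c by (intro mult_right_mono) (auto simp: n_def)
  also have "\<dots> \<le> (\<Sum>k = N + 1..n. u k)"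
    using sum_mono[of "{N + 1..n}" "\<lambda>_. c" u] N by simp
  also have "\<dots> \<le> (\<Sum>k = 1..n. u k)"
    by (rule sum_mono2) (auto simp: nonneg)
  finally have "c / 2 \<le> (1 / real n) * (\<Sum>k = 1..n. u k)"
    by (simp add: n_def field_simps)
  with M[of n] show False by (simp add: n_def)
qed

lemma averages_eventually_0:
  fixes u :: "nat \<Rightarrow> real"
  assumes "\<forall>\<^sub>F k in sequentially. u k = 0"
  shows "(\<lambda>n. (1 / real n) * (\<Sum>k = 1..n. u k)) \<longlonglongrightarrow> 0"
proof -
  obtain N where N: "\<And>k. k \<ge> N \<Longrightarrow> u k = 0"
    using assms by (auto simp: eventually_sequentially)
  have "\<forall>\<^sub>F n in sequentially.
      (1 / real n) * (\<Sum>k = 1..N. u k) = (1 / real n) * (\<Sum>k = 1..n. u k)"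
  proof (rule eventually_sequentiallyI)
    fix n assume "N \<le> n"
    then have "(\<Sum>k = 1..n. u k) = (\<Sum>k = 1..N. u k)"
      using N by (intro sum.mono_neutral_right) auto
    then show "(1 / real n) * (\<Sum>k = 1..N. u k) = (1 / real n) * (\<Sum>k = 1..n. u k)"
      by simp
  qed
  moreover have "(\<lambda>n. (1 / real n) * (\<Sum>k = 1..N. u k)) \<longlonglongrightarrow> 0"
    by (intro tendsto_mult_left_zero lim_1_over_n)
  ultimately show ?thesis
    by (rule Lim_transform_eventually[rotated])
qed

text \<open>If the limits were \<open>e + 2 * d\<close> apart, then at every \<open>k\<close> one of
  the two sequences would be at least \<open>d\<close> away from its limit, and the two averages
  could not both tend to 0.\<close>

lemma wp_summable_to_dist_le:
  assumes p: "0 < p" and y: "wp_summable_to p y L" and z: "wp_summable_to p z M"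
    and close: "\<And>k. norm (y k - z k) \<le> e"
  shows "norm (L - M) \<le> e"
proof (rule ccontr)
  assume "\<not> norm (L - M) \<le> e"
  define d where "d = (norm (L - M) - e) / 2"
  have d: "0 < d" using \<open>\<not> norm (L - M) \<le> e\<close> by (simp add: d_def)
  have d_eq: "norm (L - M) = e + 2 * d" by (simp add: d_def field_simps)
  let ?u = "\<lambda>k. norm (y k - L) powr p + norm (z k - M) powr p"
  have "d powr p \<le> ?u k" for k
  proof -
    have "norm (L - M) = norm ((y k - z k) - (y k - L) + (z k - M))"
      by (simp add: algebra_simps)
    also have "\<dots> \<le> norm (y k - z k) + norm (y k - L) + norm (z k - M)"
      using norm_triangle_ineq[of "(y k - z k) - (y k - L)" "z k - M"]
        norm_triangle_ineq4[of "y k - z k" "y k - L"] by linarith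
    finally have "d \<le> norm (y k - L) \<or> d \<le> norm (z k - M)"
      using close[of k] d_eq by argo
    then have "d powr p \<le> norm (y k - L) powr p \<or> d powr p \<le> norm (z k - M) powr p"
      using d p by (auto intro: powr_mono2)
    then show ?thesis
      using powr_ge_zero[of "norm (y k - L)" p] powr_ge_zero[of "norm (z k - M)" p] by linarith
  qed
  then have "\<not> (\<lambda>n. (1 / real n) * (\<Sum>k = 1..n. ?u k)) \<longlonglongrightarrow> 0"
    using d by (intro averages_not_null[where c = "d powr p"]) auto
  moreover have "(\<lambda>n. (1 / real n) * (\<Sum>k = 1..n. ?u k)) \<longlonglongrightarrow> 0"
    using tendsto_add[OF y[unfolded wp_summable_to_def] z[unfolded wp_summable_to_def]]
    by (simp add: sum.distrib algebra_simps)
  ultimately show False by blast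
qed

text \<open>The limits of the \<open>y m\<close> form a Cauchy sequence, and completeness supplies
  the candidate \<open>l\<close>. The deviation of \<open>z\<close> from \<open>l\<close> exceeds
  that of a single late \<open>y m\<close> from its own limit by at most a small constant.\<close>

lemma wp_summable_uniform_limit:
  fixes y :: "nat \<Rightarrow> nat \<Rightarrow> 'a::banach"
  assumes p: "0 < p" and y: "\<And>m. wp_summable p (y m)"
    and lim: "uniform_limit UNIV y z sequentially"
  shows "wp_summable p z"
proof -
  obtain L where L: "\<And>m. wp_summable_to p (y m) (L m)"
    using y unfolding wp_summable_def by metis
  have near: "\<exists>N. \<forall>m\<ge>N. \<forall>k. norm (y m k - z k) < e" if "0 < e" for e
    using uniform_limitD[OF lim that] by (simp add: eventually_sequentially dist_norm)
  have "Cauchy L"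
  proof (rule CauchyI)
    fix e :: real assume e: "0 < e"
    obtain N where N: "\<And>m k. m \<ge> N \<Longrightarrow> norm (y m k - z k) < e / 4"
      using near[of "e / 4"] e by auto
    have "norm (L m - L n) < e" if "m \<ge> N" "n \<ge> N" for m n
    proof -
      have "norm (y m k - y n k) \<le> e / 2" for k
        using norm_triangle_ineq4[of "y m k - z k" "y n k - z k"] N[OF that(1), of k]
          N[OF that(2), of k] by simp
      then have "norm (L m - L n) \<le> e / 2"
        by (rule wp_summable_to_dist_le[OF p L L])
      with e show ?thesis by simp
    qed
    then show "\<exists>M. \<forall>m\<ge>M. \<forall>n\<ge>M. norm (L m - L n) < e" by blast
  qed
  then obtain l where l: "L \<longlonglongrightarrow> l"
    using Cauchy_convergent_iff convergent_def by blast
  have "wp_summable_to p z l"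
    unfolding wp_summable_to_def
  proof (rule tendstoI)
    fix e :: real assume e: "0 < e"
    \<comment> \<open>Solves \<open>2 powr p * d powr p = e / 2\<close>: the constant deviation
      \<open>d\<close> uses up half of \<open>e\<close>, and the average belonging to
      \<open>y m\<close> gets the other half.\<close>
    define d where "d = (e / (2 * 2 powr p)) powr (1 / p)"
    have d: "0 < d" "2 powr p * d powr p = e / 2"
      using e p by (auto simp: d_def powr_powr)
    obtain N where N: "\<And>m k. m \<ge> N \<Longrightarrow> norm (y m k - z k) < d / 2"
      using near[of "d / 2"] d by auto
    have "\<forall>\<^sub>F m in sequentially. dist (L m) l < d / 2"
      using tendstoD[OF l, of "d / 2"] d(1) by simp
    then obtain m where m: "m \<ge> N" "norm (L m - l) < d / 2"
      unfolding eventually_sequentially dist_norm by (metis nle_le)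
    have bound: "norm (z k - l) powr p
        \<le> 2 powr p * (norm (y m k - L m) powr p + d powr p)" for k
    proof -
      have "z k - l = (y m k - L m) - (y m k - z k) + (L m - l)" by simp
      also have "norm \<dots> \<le> norm (y m k - L m) + norm (y m k - z k) + norm (L m - l)"
        using norm_triangle_ineq[of "(y m k - L m) - (y m k - z k)" "L m - l"]
          norm_triangle_ineq4[of "y m k - L m" "y m k - z k"] by linarith
      also have "\<dots> \<le> norm (y m k - L m) + d"
        using N[OF m(1), of k] m(2) by linarith
      finally have "norm (z k - l) powr p \<le> (norm (y m k - L m) + d) powr p"
        using p by (intro powr_mono2) auto
      also have "\<dots> \<le> 2 powr p * (norm (y m k - L m) powr p + d powr p)"
        using d p by (intro powr_add_le) auto
      finally show ?thesis .
    qed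
    have "\<forall>\<^sub>F n in sequentially.
        (1 / real n) * (\<Sum>k = 1..n. norm (y m k - L m) powr p) < e / (2 * 2 powr p)"
      using L[of m] e unfolding wp_summable_to_def by (intro order_tendstoD) auto
    then show "\<forall>\<^sub>F n in sequentially.
        dist ((1 / real n) * (\<Sum>k = 1..n. norm (z k - l) powr p)) 0 < e"
      using eventually_gt_at_top[of 0]
    proof eventually_elim
      case (elim n)
      have "(\<Sum>k = 1..n. norm (z k - l) powr p)
          \<le> (\<Sum>k = 1..n. 2 powr p * (norm (y m k - L m) powr p + d powr p))"
        by (intro sum_mono bound)
      also have "\<dots> = 2 powr p * (\<Sum>k = 1..n. norm (y m k - L m) powr p) + real n * (e / 2)"
        by (simp add: distrib_left sum.distrib sum_distrib_left d(2))
      also have "\<dots> < real n * e"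
        using elim by (simp add: field_simps)
      finally have "(1 / real n) * (\<Sum>k = 1..n. norm (z k - l) powr p) < e"
        using elim by (simp add: field_simps)
      then show ?case by (simp add: sum_nonneg)
    qed
  qed
  then show ?thesis by (auto simp: wp_summable_def)
qed

section \<open>Multiplier spaces\<close>

text \<open>
  The library instance \<open>bcontfun :: (metric_space, complete_space) complete_space\<close> does not apply to
  \<^typ>\<open>linfty\<close>, because \<^typ>\<open>nat\<close> is not an instance of \<^class>\<open>metric_space\<close>.
\<close>
lemma complete_bcontfun_iff_closed:
  fixes S :: "('a::topological_space \<Rightarrow>\<^sub>C 'b::complete_space) set"
  shows "complete S \<longleftrightarrow> closed S"
proof
  show "closed S" if "complete S"
    using that by (rule complete_imp_closed)
  have "complete (UNIV :: ('a \<Rightarrow>\<^sub>C 'b) set)"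
  proof (rule completeI)
    fix f :: "nat \<Rightarrow> 'a \<Rightarrow>\<^sub>C 'b"
    assume "Cauchy f"
    \<comment> \<open>A sup-norm Cauchy sequence is uniformly Cauchy as a sequence of functions, and
      its uniform limit is again bounded and continuous.\<close>
    then obtain g where "uniform_limit UNIV f g sequentially"
      using uniformly_convergent_eq_cauchy[of "\<lambda>_. True" f]
      unfolding Cauchy_def uniform_limit_sequentially_iff
      by (metis dist_fun_lt_imp_dist_val_lt)
    then obtain l where "f \<longlonglongrightarrow> l"
      by (rule uniform_limit_bcontfunE) simp
    then show "\<exists>l\<in>UNIV. f \<longlonglongrightarrow> l" by blast
  qed
  then show "complete S" if "closed S"
    using that complete_closed_subset by blast
qed

text \<open>For \<open>\<bar>a i\<bar> \<le> 1\<close> each functional \<open>f\<close> is bounded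
  on the finite sums by the total of \<open>\<bar>f (x i)\<bar>\<close>, so these sums are weakly
  bounded and hence norm bounded. Scaling gives general \<open>c\<close>.\<close>

lemma wuc_series_bounded_multipliers:
  fixes x :: "nat \<Rightarrow> 'a::real_normed_vector"
  assumes "wuc_series x"
  obtains H where "\<And>(a :: nat \<Rightarrow> real) c n. (\<And>i. \<bar>a i\<bar> \<le> c) \<Longrightarrow> norm (\<Sum>i<n. a i *\<^sub>R x i) \<le> H * c"
proof -
  define S where "S = {\<Sum>i<n. a i *\<^sub>R x i | (a :: nat \<Rightarrow> real) n. \<forall>i. \<bar>a i\<bar> \<le> 1}"
  have "bounded S"
  proof (rule weakly_bounded_imp_bounded)
    fix f :: "'a \<Rightarrow>\<^sub>L real"
    have f: "summable (\<lambda>i. \<bar>blinfun_apply f (x i)\<bar>)"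
      using assms by (simp add: wuc_series_def)
    have "\<bar>blinfun_apply f (\<Sum>i<n. a i *\<^sub>R x i)\<bar> \<le> (\<Sum>i. \<bar>blinfun_apply f (x i)\<bar>)"
      if "\<And>i. \<bar>a i\<bar> \<le> 1" for a :: "nat \<Rightarrow> real" and n
    proof -
      have "\<bar>blinfun_apply f (\<Sum>i<n. a i *\<^sub>R x i)\<bar> \<le> (\<Sum>i<n. \<bar>a i * blinfun_apply f (x i)\<bar>)"
        by (simp add: blinfun.bilinear_simps)
      also have "\<dots> \<le> (\<Sum>i<n. \<bar>blinfun_apply f (x i)\<bar>)"
        using that by (intro sum_mono) (simp add: abs_mult mult_left_le_one_le)
      also have "\<dots> \<le> (\<Sum>i. \<bar>blinfun_apply f (x i)\<bar>)"
        by (rule sum_le_suminf[OF f]) auto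
      finally show ?thesis .
    qed
    then show "bounded (blinfun_apply f ` S)"
      unfolding bounded_iff by (intro exI[of _ "\<Sum>i. \<bar>blinfun_apply f (x i)\<bar>"]) (auto simp: S_def)
  qed
  then obtain H where H: "\<And>v. v \<in> S \<Longrightarrow> norm v \<le> H"
    by (auto simp: bounded_iff)
  have "norm (\<Sum>i<n. a i *\<^sub>R x i) \<le> H * c" if a: "\<And>i. \<bar>a i\<bar> \<le> c" for a :: "nat \<Rightarrow> real" and c n
  \<comment> \<open>The multipliers are normalised by dividing by \<open>c\<close>; if
    \<open>c = 0\<close> they all vanish.\<close>
  proof (cases "c = 0")
    case True
    with a show ?thesis by simp
  next
    case False
    with a[of 0] have c: "0 < c" by simp
    then have "\<forall>i. \<bar>a i / c\<bar> \<le> 1"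
      using a by simp
    then have "(\<Sum>i<n. (a i / c) *\<^sub>R x i) \<in> S"
      unfolding S_def by (intro CollectI exI[of _ "\<lambda>i. a i / c"] exI[of _ n]) auto
    then have "norm (\<Sum>i<n. (a i / c) *\<^sub>R x i) \<le> H"
      by (rule H)
    moreover have "(\<Sum>i<n. a i *\<^sub>R x i) = c *\<^sub>R (\<Sum>i<n. (a i / c) *\<^sub>R x i)"
      using c by (simp add: scaleR_sum_right)
    ultimately show ?thesis
      using c by (simp add: mult.commute)
  qed
  with that show ?thesis by blast
qed

text \<open>\<open>H\<close> is a Lipschitz constant, uniform in \<open>k\<close>, for the passage
  from multipliers to partial sums; it turns sup-norm limits into uniform limits.\<close>

lemma closed_S_wp:
  fixes x :: "nat \<Rightarrow> 'a::banach"
  assumes p: "0 < p" and x: "wuc_series x"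
  shows "closed (S_wp p x)"
  unfolding closed_sequential_limits
proof (intro allI impI, elim conjE)
  fix s a
  assume s: "\<forall>m. s m \<in> S_wp p x" and lim: "s \<longlonglongrightarrow> a"
  obtain H where H: "\<And>(a :: nat \<Rightarrow> real) c n. (\<And>i. \<bar>a i\<bar> \<le> c) \<Longrightarrow> norm (\<Sum>i<n. a i *\<^sub>R x i) \<le> H * c"
    using wuc_series_bounded_multipliers[OF x] by blast
  have close: "norm ((\<Sum>i<k. s m i *\<^sub>R x i) - (\<Sum>i<k. a i *\<^sub>R x i)) \<le> H * dist (s m) a" for m k
    using H[of "\<lambda>i. s m i - a i" "dist (s m) a" k] dist_bounded[of "s m" _ a]
    by (simp add: dist_real_def scaleR_left_diff_distrib sum_subtractf)
  have "uniform_limit UNIV (\<lambda>m k. \<Sum>i<k. s m i *\<^sub>R x i) (\<lambda>k. \<Sum>i<k. a i *\<^sub>R x i) sequentially"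
  proof (rule uniform_limitI)
    fix e :: real assume e: "0 < e"
    have "(\<lambda>m. H * dist (s m) a) \<longlonglongrightarrow> 0"
      using lim unfolding tendsto_dist_iff[of s] by (rule tendsto_mult_right_zero)
    then have "\<forall>\<^sub>F m in sequentially. H * dist (s m) a < e"
      using e by (rule order_tendstoD)
    then show "\<forall>\<^sub>F m in sequentially. \<forall>k\<in>UNIV.
        dist (\<Sum>i<k. s m i *\<^sub>R x i) (\<Sum>i<k. a i *\<^sub>R x i) < e"
      by eventually_elim (simp add: dist_norm le_less_trans[OF close])
  qed
  moreover have "wp_summable p (\<lambda>k. \<Sum>i<k. s m i *\<^sub>R x i)" for m
    using s by (simp add: S_wp_def wp_summable_series_def)
  ultimately have "wp_summable p (\<lambda>k. \<Sum>i<k. a i *\<^sub>R x i)"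
    by (rule wp_summable_uniform_limit[OF p, rotated])
  then show "a \<in> S_wp p x"
    by (simp add: S_wp_def wp_summable_series_def)
qed

lemma finitely_supported_in_S_wp:
  assumes "\<And>i. N \<le> i \<Longrightarrow> apply_bcontfun a i = 0"
  shows "a \<in> S_wp p x"
proof -
  have "norm ((\<Sum>i<k. a i *\<^sub>R x i) - (\<Sum>i<N. a i *\<^sub>R x i)) powr p = 0" if "N \<le> k" for k
  proof -
    have "(\<Sum>i<k. a i *\<^sub>R x i) = (\<Sum>i<N. a i *\<^sub>R x i)"
      using that assms by (intro sum.mono_neutral_right) auto
    \<comment> \<open>\<open>0 powr p\<close> is 0 for every real \<open>p\<close>, including
      \<open>p = 0\<close>.\<close>
    then show ?thesis by simp
  qed
  then have "wp_summable_to p (\<lambda>k. \<Sum>i<k. a i *\<^sub>R x i) (\<Sum>i<N. a i *\<^sub>R x i)"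
    unfolding wp_summable_to_def
    by (intro averages_eventually_0 eventually_sequentiallyI)
  then show ?thesis
    by (auto simp: S_wp_def wp_summable_series_def wp_summable_def)
qed

text \<open>Continuity is automatic on the discrete space of naturals, so only boundedness has to be
  checked.\<close>

lemma bcontfun_of_bounded_sequence:
  fixes a :: "nat \<Rightarrow> real"
  assumes "bounded (range a)"
  shows "apply_bcontfun (Bcontfun a) = a"
  using assms by (intro Bcontfun_inverse) (simp add: bcontfun_def)

lemma c0_subset_if_closed:
  assumes "closed (S_wp p x)"
  shows "c0 \<subseteq> S_wp p x"
proof
  fix a assume a: "a \<in> c0"
  \<comment> \<open>Truncations of \<open>a\<close>: the error lives on the tail
    \<open>i \<ge> m\<close>, where a null sequence is uniformly small.\<close>
  define s where "s m = Bcontfun (\<lambda>i. if i < m then apply_bcontfun a i else 0)" for m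
  have s: "apply_bcontfun (s m) = (\<lambda>i. if i < m then apply_bcontfun a i else 0)" for m
    unfolding s_def
  proof (rule bcontfun_of_bounded_sequence)
    show "bounded (range (\<lambda>i. if i < m then apply_bcontfun a i else 0))"
      using norm_bounded[of a] by (intro boundedI[of _ "norm a"]) auto
  qed
  have "s \<longlonglongrightarrow> a"
  proof (rule uniform_limit_tendsto_bcontfun, rule uniform_limitI)
    fix e :: real assume e: "0 < e"
    then obtain N where N: "\<And>i. i \<ge> N \<Longrightarrow> \<bar>apply_bcontfun a i\<bar> < e"
      using a by (auto simp: c0_def LIMSEQ_iff)
    have "dist (s m i) (a i) < e" if "N \<le> m" for m i
      using that e N[of i] by (auto simp: s dist_real_def)
    then show "\<forall>\<^sub>F m in sequentially. \<forall>i\<in>UNIV. dist (s m i) (a i) < e"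
      by (auto simp: eventually_sequentially)
  qed
  moreover have "s m \<in> S_wp p x" for m
    by (rule finitely_supported_in_S_wp[of m]) (simp add: s)
  ultimately show "a \<in> S_wp p x"
    using assms by (auto simp: closed_sequential_limits)
qed

text \<open>
  The multipliers are the signs of \<open>t i\<close> damped by the square root of the partial sums of
  \<open>\<bar>t i\<bar>\<close>, so the damped partial sums still grow like the square root of the undamped ones.
\<close>
lemma null_multipliers_of_divergent_series:
  fixes t :: "nat \<Rightarrow> real"
  assumes "\<not> summable (\<lambda>i. \<bar>t i\<bar>)"
  obtains a where "a \<longlonglongrightarrow> 0" "filterlim (\<lambda>n. \<Sum>i<n. a i * t i) at_top sequentially"
proof
  \<comment> \<open>The summand 1 keeps all divisors positive, even when the first terms of
    \<open>t\<close> vanish.\<close>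
  define T where "T n = 1 + (\<Sum>i<n. \<bar>t i\<bar>)" for n
  define a where "a i = sgn (t i) / sqrt (T (Suc i))" for i
  have T_mono: "T m \<le> T n" if "m \<le> n" for m n
    unfolding T_def using that by (intro add_left_mono sum_mono2) auto
  have T_pos: "1 \<le> T n" for n
    by (simp add: T_def sum_nonneg)
  \<comment> \<open>The partial sums increase, so if they did not tend to infinity they would be
    bounded and the series summable.\<close>
  have "filterlim (\<lambda>n. \<Sum>i<n. \<bar>t i\<bar>) at_top sequentially"
  proof (rule ccontr)
    assume no: "\<not> ?thesis"
    obtain B where B: "\<And>n. (\<Sum>i<n. \<bar>t i\<bar>) \<le> B"
    proof -
      from no obtain B where "\<not> (\<forall>\<^sub>F n in sequentially. B \<le> (\<Sum>i<n. \<bar>t i\<bar>))"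
        by (auto simp: filterlim_at_top)
      then have "\<exists>m\<ge>n. (\<Sum>i<m. \<bar>t i\<bar>) < B" for n
        by (auto simp: eventually_sequentially not_le)
      moreover have "(\<Sum>i<n. \<bar>t i\<bar>) \<le> (\<Sum>i<m. \<bar>t i\<bar>)" if "n \<le> m" for n m
        using that by (intro sum_mono2) auto
      ultimately have "(\<Sum>i<n. \<bar>t i\<bar>) \<le> B" for n
        by (meson less_imp_le order_trans)
      with that show ?thesis by blast
    qed
    then have "summable (\<lambda>i. \<bar>t i\<bar>)"
      by (intro summableI_nonneg_bounded) auto
    with assms show False by blast
  qed
  then have T_top: "filterlim T at_top sequentially"
    unfolding T_def by (rule filterlim_tendsto_add_at_top[OF tendsto_const])
  have sqrt_top: "filterlim (\<lambda>n. sqrt (T n)) at_top sequentially"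
    by (rule filterlim_compose[OF sqrt_at_top T_top])
  show "a \<longlonglongrightarrow> 0"
  proof (rule Lim_null_comparison)
    show "\<forall>\<^sub>F i in sequentially. norm (a i) \<le> inverse (sqrt (T (Suc i)))"
      using T_pos by (intro always_eventually allI)
        (auto simp: a_def abs_mult sgn_if divide_inverse order_trans[OF zero_le_one])
    show "(\<lambda>i. inverse (sqrt (T (Suc i)))) \<longlonglongrightarrow> 0"
      by (intro tendsto_inverse_0_at_top filterlim_compose[OF sqrt_top filterlim_Suc])
  qed
  have "sqrt (T n) - 1 \<le> (\<Sum>i<n. a i * t i)" for n
  proof -
    \<comment> \<open>Every divisor \<open>sqrt (T (Suc i))\<close> with \<open>i < n\<close> is
      replaced by the larger \<open>sqrt (T n)\<close>, which factors out and leaves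
      \<open>T n - 1\<close>.\<close>
    have "(T n - 1) / sqrt (T n) \<le> (\<Sum>i<n. a i * t i)"
    proof -
      have "(T n - 1) / sqrt (T n) = (\<Sum>i<n. \<bar>t i\<bar> / sqrt (T n))"
        by (simp add: T_def sum_divide_distrib)
      also have "\<dots> \<le> (\<Sum>i<n. \<bar>t i\<bar> / sqrt (T (Suc i)))"
      proof (intro sum_mono divide_left_mono)
        fix i assume "i \<in> {..<n}"
        then show "sqrt (T (Suc i)) \<le> sqrt (T n)"
          using T_mono[of "Suc i" n] by simp
        show "0 < sqrt (T n) * sqrt (T (Suc i))"
          using T_pos[of "Suc i"] T_pos[of n] by simp
      qed auto
      also have "\<dots> = (\<Sum>i<n. a i * t i)"
        by (intro sum.cong) (auto simp: a_def sgn_if)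
      finally show ?thesis .
    qed
    moreover have "sqrt (T n) - 1 \<le> (T n - 1) / sqrt (T n)"
    proof -
      have "1 \<le> sqrt (T n)" using T_pos[of n] by simp
      then have "sqrt (T n) - 1 \<le> sqrt (T n) - 1 / sqrt (T n)"
        by simp
      also have "\<dots> = (T n - 1) / sqrt (T n)"
        using T_pos[of n] by (simp add: diff_divide_distrib real_div_sqrt)
      finally show ?thesis .
    qed
    ultimately show ?thesis by linarith
  qed
  then have le: "\<forall>\<^sub>F n in sequentially. sqrt (T n) - 1 \<le> (\<Sum>i<n. a i * t i)"
    by simp
  have "filterlim (\<lambda>n. sqrt (T n) - 1) at_top sequentially"
    using filterlim_tendsto_add_at_top[OF tendsto_const sqrt_top, of "- 1"] by simp
  then show "filterlim (\<lambda>n. \<Sum>i<n. a i * t i) at_top sequentially"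
    using le by (rule filterlim_at_top_mono)
qed

lemma not_wp_summable_if_functional_unbounded:
  fixes y :: "nat \<Rightarrow> 'a::real_normed_vector" and f :: "'a \<Rightarrow>\<^sub>L real"
  assumes p: "0 < p" and top: "filterlim (\<lambda>k. blinfun_apply f (y k)) at_top sequentially"
  shows "\<not> wp_summable p y"
proof
  assume "wp_summable p y"
  then obtain L where L: "wp_summable_to p y L"
    by (auto simp: wp_summable_def)
  \<comment> \<open>The threshold is chosen so that \<open>f (y k - L)\<close> exceeds
    \<open>norm f\<close>, which forces \<open>norm (y k - L)\<close> above 1 and keeps the averages
    away from 0.\<close>
  have "\<forall>\<^sub>F k in sequentially. norm f + f L < blinfun_apply f (y k)"
    using top by (auto simp: filterlim_at_top_dense)
  then have "\<forall>\<^sub>F k in sequentially. 1 \<le> norm (y k - L) powr p"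
  proof eventually_elim
    case (elim k)
    then have "norm f * 1 < norm f * norm (y k - L)"
      using norm_blinfun[of f "y k - L"] by (simp add: blinfun.bilinear_simps)
    then have "1 \<le> norm (y k - L)"
      using mult_less_cancel_left_pos[of "norm f" 1] by (cases "norm f = 0") auto
    then show ?case
      using p by (simp add: ge_one_powr_ge_zero)
  qed
  then show False
    using L averages_not_null[of "\<lambda>k. norm (y k - L) powr p" 1] by (simp add: wp_summable_to_def)
qed

lemma wuc_series_if_c0_subset:
  fixes x :: "nat \<Rightarrow> 'a::real_normed_vector"
  assumes p: "0 < p" and c0: "c0 \<subseteq> S_wp p x"
  shows "wuc_series x"
  unfolding wuc_series_def
proof (rule allI, rule ccontr)
  fix f :: "'a \<Rightarrow>\<^sub>L real"
  assume "\<not> summable (\<lambda>i. \<bar>blinfun_apply f (x i)\<bar>)"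
  then obtain a where a: "a \<longlonglongrightarrow> 0"
      and top: "filterlim (\<lambda>n. \<Sum>i<n. a i * blinfun_apply f (x i)) at_top sequentially"
    by (rule null_multipliers_of_divergent_series)
  \<comment> \<open>A null sequence is bounded, so \<open>Bcontfun a\<close> really represents
    \<open>a\<close>.\<close>
  have ap: "apply_bcontfun (Bcontfun a) = a"
    using convergent_imp_bounded[OF a] by (rule bcontfun_of_bounded_sequence)
  then have "Bcontfun a \<in> S_wp p x"
    using c0 a by (auto simp: c0_def)
  then have "wp_summable p (\<lambda>k. \<Sum>i<k. a i *\<^sub>R x i)"
    by (simp add: S_wp_def wp_summable_series_def ap)
  moreover have "filterlim (\<lambda>k. blinfun_apply f (\<Sum>i<k. a i *\<^sub>R x i)) at_top sequentially"
    using top by (simp add: blinfun.bilinear_simps)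
  ultimately show False
    using not_wp_summable_if_functional_unbounded[OF p, of f "\<lambda>k. \<Sum>i<k. a i *\<^sub>R x i"] by blast
qed

theorem theorem3p1:
  fixes x :: "nat \<Rightarrow> 'a::banach" and p :: real
  assumes "0 < p"
  shows "(wuc_series x \<longleftrightarrow> complete (S_wp p x)) \<and>
         (complete (S_wp p x) \<longleftrightarrow> c0 \<subseteq> S_wp p x)"
  \<comment> \<open>With completeness read as closedness, the three implications form a
    cycle.\<close>
  using closed_S_wp[OF assms, of x] c0_subset_if_closed[of p x] wuc_series_if_c0_subset[OF assms, of x]
  unfolding complete_bcontfun_iff_closed by blast

end
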